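(* Let $K$ be a field, $V$ a vector space over $K$, $A:V\to V$ a linear operator, $b_1,\dots,b_n\in K$ and $\varphi_1,\dots,\varphi_n\in V$. Suppose $\sum_{i=1}^n b_i\neq 0$. Then there is a nonsingular matrix $S\in K^{n\times n}$ with $J=S^{-1}\hat B S$ such that, for every column $\vec x=[x_1\ \dots\ x_n]^T\in V^{n\times 1}$, setting $\vec y=[y_1\ \dots\ y_n]^T=S^{-1}\vec x$ and $\vec\psi=[\psi_1\ \dots\ \psi_n]^T=S^{-1}\vec\varphi$, the column $\vec x$ satisfies the system $$A(x_j)=b_jx_1+b_jx_2+\dots+b_jx_n+\varphi_j,\qquad 1\le j\le n,$$ if and only if $\vec y$ satisfies the system $$A(y_j)=\psi_j\quad(1\le j\le n-1),\qquad A(y_n)=\Big(\sum_{i=1}^n b_i\Big)y_n+\psi_n.$$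
   Context: $\hat B\in K^{n\times n}$ is the matrix whose $(j,k)$ entry is $b_j$ for all $1\le j,k\le n$ (all entries of row $j$ equal $b_j$). $J=\mathrm{diag}(0,0,\dots,0,\sum_{i=1}^n b_i)\in K^{n\times n}$ is the Jordan canonical form of $\hat B$ when $\sum_{i=1}^n b_i\ne0$. $\vec\varphi=[\varphi_1\ \dots\ \varphi_n]^T\in V^{n\times 1}$. A matrix over $K$ acts on columns in $V^{n\times 1}$ by the usual matrix-times-column rule using scalar multiplication in $V$. *)

theory Defs
  imports "Jordan_Normal_Form.Matrix"
begin

text \<open>
  Matrices over the field and columns of vectors are the types \<open>'k mat\<close> and \<open>'v vec\<close>, whose
  indices start at 0; row \<open>j\<close> in the usual numbering has index \<open>j - 1\<close>, the last one \<open>n - 1\<close>.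
\<close>

definition B_hat :: "nat \<Rightarrow> 'k vec \<Rightarrow> 'k mat" where
  "B_hat n b = mat n n (\<lambda>(j, k). b $ j)"

definition J_mat :: "nat \<Rightarrow> 'k::comm_monoid_add vec \<Rightarrow> 'k mat" where
  "J_mat n b = mat_diag n (\<lambda>j. if j = n - 1 then \<Sum>i<n. b $ i else 0)"

text \<open>
  The library product of a matrix and a vector has a single entry type, whereas here the entries of
  the matrix are scalars and those of the column are elements of the vector space.
\<close>

definition mat_act :: "('k \<Rightarrow> 'v \<Rightarrow> 'v) \<Rightarrow> 'k mat \<Rightarrow> 'v::comm_monoid_add vec \<Rightarrow> 'v vec" where
  "mat_act scale M x = vec (dim_row M) (\<lambda>j. \<Sum>k<dim_col M. scale (M $$ (j, k)) (x $ k))"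

end

theory Submission
  imports Defs "Jordan_Normal_Form.Determinant"
begin

text \<open>
  Two independent facts carry the proof. First, a linear operator applied entrywise commutes with
  the action of scalar matrices on columns, so an invertible change of unknowns \<open>y = S\<inverse> x\<close>
  turns the system \<open>A x = B x + \<phi>\<close> into \<open>A y = (S\<inverse> B S) y + S\<inverse> \<phi>\<close>; this holds for every
  matrix \<open>B\<close> (lemma \<open>linear_system_change_of_unknowns\<close>).

  Secondly, \<open>B_hat n b\<close> is the rank-one map \<open>x \<mapsto> (\<Sum>i. x\<^sub>i) b\<close>. Write \<open>s\<close> for the sum of the
  entries of \<open>b\<close>. The kernel consists of the columns of entry sum \<open>0\<close>, which have the basis
  \<open>e\<^sub>j - e\<^sub>m\<close> for \<open>j < m\<close>, where \<open>m = n - 1\<close> is the last index, and \<open>b\<close> itself is an eigenvector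
  with eigenvalue \<open>s\<close>. As \<open>s \<noteq> 0\<close>, the column \<open>b\<close> lies outside the kernel, so these vectors form
  an eigenbasis, which supplies the columns of \<open>S\<close>. The coordinates of \<open>x\<close> in this basis can be
  read off: since the kernel part does not contribute to the entry sum, the coefficient of \<open>b\<close>
  is \<open>c = (\<Sum>i. x\<^sub>i) / s\<close>, and the coefficient of \<open>e\<^sub>j - e\<^sub>m\<close> is the \<open>j\<close>-th entry of \<open>x - c b\<close>,
  namely \<open>x\<^sub>j - c b\<^sub>j\<close>. This gives \<open>S\<inverse>\<close> explicitly.
\<close>

section \<open>Scalar matrices acting on columns of vectors\<close>

lemma dim_mat_act [simp]: "dim_vec (mat_act scale M x) = dim_row M"
  by (simp add: mat_act_def)

lemma mat_act_carrier: "M \<in> carrier_mat m n \<Longrightarrow> mat_act scale M x \<in> carrier_vec m"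
  by (intro carrier_vecI) simp

lemma index_mat_act:
  "M \<in> carrier_mat m n \<Longrightarrow> j < m \<Longrightarrow> mat_act scale M x $ j = (\<Sum>k<n. scale (M $$ (j, k)) (x $ k))"
  by (simp add: mat_act_def)

context vector_space
begin

lemma mat_act_one:
  assumes "x \<in> carrier_vec n"
  shows "mat_act scale (1\<^sub>m n) x = x"
proof (rule eq_vecI)
  fix j assume "j < dim_vec x"
  then have j: "j < n" using assms by simp
  have "mat_act scale (1\<^sub>m n) x $ j = (\<Sum>k<n. if k = j then x $ k else 0)"
    unfolding index_mat_act[OF one_carrier_mat j] using j by (intro sum.cong) auto
  then show "mat_act scale (1\<^sub>m n) x $ j = x $ j" using j by simp
qed (use assms in simp)

lemma mat_act_mult:
  assumes M: "M \<in> carrier_mat l m" and N: "N \<in> carrier_mat m n"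
  shows "mat_act scale (M * N) x = mat_act scale M (mat_act scale N x)"
proof (rule eq_vecI)
  fix i assume "i < dim_vec (mat_act scale M (mat_act scale N x))"
  then have i: "i < l" using M by simp
  have "mat_act scale (M * N) x $ i = (\<Sum>k<n. \<Sum>j<m. scale (M $$ (i, j) * N $$ (j, k)) (x $ k))"
    unfolding index_mat_act[OF mult_carrier_mat[OF M N] i] using M N i
    by (intro sum.cong) (auto simp: scalar_prod_def scale_sum_left atLeast0LessThan)
  also have "\<dots> = (\<Sum>j<m. \<Sum>k<n. scale (M $$ (i, j) * N $$ (j, k)) (x $ k))"
    by (rule sum.swap)
  also have "\<dots> = mat_act scale M (mat_act scale N x) $ i"
    unfolding index_mat_act[OF M i]
    by (intro sum.cong) (auto simp: index_mat_act[OF N] scale_sum_right)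
  finally show "mat_act scale (M * N) x $ i = mat_act scale M (mat_act scale N x) $ i" .
qed (use M in simp)

lemma mat_act_add:
  assumes M: "M \<in> carrier_mat m n" and x: "x \<in> carrier_vec n" and y: "y \<in> carrier_vec n"
  shows "mat_act scale M (x + y) = mat_act scale M x + mat_act scale M y"
  using assms by (intro eq_vecI) (auto simp: mat_act_def scale_right_distrib sum.distrib)

end

lemma linear_mat_act:
  assumes "Vector_Spaces.linear scale scale A"
    and M: "M \<in> carrier_mat m n" and x: "x \<in> carrier_vec n"
  shows "map_vec A (mat_act scale M x) = mat_act scale M (map_vec A x)"
proof -
  interpret Vector_Spaces.linear scale scale A by fact
  show ?thesis
    using M x by (intro eq_vecI) (auto simp: mat_act_def sum scale)
qed

text \<open>
  Applying the matrix \<open>T\<close> to both sides of the first system gives the second, because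
  \<open>T B = (T B S) T\<close>; applying \<open>S\<close> goes back, so no solutions are gained.
\<close>

lemma linear_system_change_of_unknowns:
  assumes lin: "Vector_Spaces.linear scale scale A"
    and S: "S \<in> carrier_mat n n" and T: "T \<in> carrier_mat n n" and B: "B \<in> carrier_mat n n"
    and ST: "S * T = 1\<^sub>m n"
    and x: "x \<in> carrier_vec n" and \<phi>: "\<phi> \<in> carrier_vec n"
  shows "map_vec A x = mat_act scale B x + \<phi> \<longleftrightarrow>
    map_vec A (mat_act scale T x)
      = mat_act scale (T * B * S) (mat_act scale T x) + mat_act scale T \<phi>"
proof -
  interpret Vector_Spaces.linear scale scale A by fact
  note cl = mat_act_carrier[OF B] mat_act_carrier[OF T] mat_act_carrier[OF S]
  have "T * B * S * T = T * B"
    using S T B ST by (simp add: assoc_mult_mat[of _ n n _ n _ n])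
  then have conj: "mat_act scale (T * B * S) (mat_act scale T x) = mat_act scale T (mat_act scale B x)"
    using S T B by (metis vs1.mat_act_mult mult_carrier_mat)
  have rhs: "mat_act scale T (mat_act scale B x + \<phi>)
      = mat_act scale (T * B * S) (mat_act scale T x) + mat_act scale T \<phi>"
    unfolding conj by (rule vs1.mat_act_add[OF T cl(1) \<phi>])
  have inj: "mat_act scale T u = mat_act scale T v \<longleftrightarrow> u = v"
    if "u \<in> carrier_vec n" "v \<in> carrier_vec n" for u v
    using that vs1.mat_act_mult[OF S T] vs1.mat_act_one ST by metis
  have "map_vec A x = mat_act scale B x + \<phi> \<longleftrightarrow>
      mat_act scale T (map_vec A x) = mat_act scale T (mat_act scale B x + \<phi>)"
    using x \<phi> cl(1) by (intro inj[symmetric] add_carrier_vec) auto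
  then show ?thesis
    unfolding linear_mat_act[OF lin T x] rhs .
qed

section \<open>An eigenbasis of a matrix with constant rows\<close>

text \<open>
  The columns are the kernel vectors \<open>e\<^sub>j - e\<^sub>n\<^sub>-\<^sub>1\<close> and, in the last place, the eigenvector \<open>b\<close>.
\<close>

definition eigenbasis_mat :: "nat \<Rightarrow> 'k::field vec \<Rightarrow> 'k mat" where
  "eigenbasis_mat n b = mat n n (\<lambda>(i, j).
     if j = n - 1 then b $ i else of_bool (i = j) - of_bool (i = n - 1))"

text \<open>
  Row \<open>j < n - 1\<close> sends a column \<open>x\<close> to \<open>x\<^sub>j - c b\<^sub>j\<close> and the last row sends it to \<open>c\<close>, where \<open>c\<close> is
  the sum of the entries of \<open>x\<close> divided by that of \<open>b\<close>.
\<close>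

definition eigencoord_mat :: "nat \<Rightarrow> 'k::field vec \<Rightarrow> 'k mat" where
  "eigencoord_mat n b = mat n n (\<lambda>(j, k).
     if j = n - 1 then 1 / (\<Sum>i<n. b $ i) else of_bool (j = k) - b $ j / (\<Sum>i<n. b $ i))"

lemma eigenbasis_mat_carrier [simp]: "eigenbasis_mat n b \<in> carrier_mat n n"
  by (simp add: eigenbasis_mat_def)

lemma eigencoord_mat_carrier [simp]: "eigencoord_mat n b \<in> carrier_mat n n"
  by (simp add: eigencoord_mat_def)

lemma B_hat_carrier [simp]: "B_hat n b \<in> carrier_mat n n"
  by (simp add: B_hat_def)

lemma J_mat_carrier [simp]: "J_mat n b \<in> carrier_mat n n"
  by (simp add: J_mat_def)

lemma index_mult_mat_sum:
  assumes "M \<in> carrier_mat l m" "N \<in> carrier_mat m n" "i < l" "k < n"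
  shows "(M * N) $$ (i, k) = (\<Sum>j<m. M $$ (i, j) * N $$ (j, k))"
  using assms by (auto simp: scalar_prod_def atLeast0LessThan)

lemma eigencoord_row_mult:
  assumes M: "M \<in> carrier_mat n p" and jk: "j < n" "k < p"
  shows "(eigencoord_mat n b * M) $$ (j, k) =
    (if j = n - 1 then (\<Sum>i<n. M $$ (i, k)) / (\<Sum>i<n. b $ i)
     else M $$ (j, k) - b $ j * ((\<Sum>i<n. M $$ (i, k)) / (\<Sum>i<n. b $ i)))"
proof -
  let ?s = "\<Sum>i<n. b $ i"
  have *: "(eigencoord_mat n b * M) $$ (j, k)
      = (\<Sum>i<n. (if j = n - 1 then 1 / ?s else of_bool (j = i) - b $ j / ?s) * M $$ (i, k))"
    unfolding index_mult_mat_sum[OF eigencoord_mat_carrier M jk]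
    using jk by (intro sum.cong) (auto simp: eigencoord_mat_def)
  show ?thesis
  proof (cases "j = n - 1")
    case True
    then show ?thesis unfolding * by (simp add: sum_divide_distrib)
  next
    case False
    have "(\<Sum>i<n. (of_bool (j = i) - b $ j / ?s) * M $$ (i, k))
        = (\<Sum>i<n. if i = j then M $$ (i, k) else 0) - (\<Sum>i<n. b $ j / ?s * M $$ (i, k))"
      unfolding sum_subtractf[symmetric] by (intro sum.cong) (auto simp: algebra_simps)
    also have "\<dots> = M $$ (j, k) - b $ j / ?s * (\<Sum>i<n. M $$ (i, k))"
      using jk by (simp only: sum_distrib_left[symmetric]) simp
    finally show ?thesis
      unfolding * using False by simp
  qed
qed

lemma eigenbasis_column_sum:
  assumes "k < n"
  shows "(\<Sum>i<n. eigenbasis_mat n b $$ (i, k)) = (if k = n - 1 then \<Sum>i<n. b $ i else 0)"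
proof (cases "k = n - 1")
  case True
  then show ?thesis using assms by (auto simp: eigenbasis_mat_def)
next
  case False
  have "(\<Sum>i<n. eigenbasis_mat n b $$ (i, k))
      = (\<Sum>i<n. (if i = k then 1 else 0) - (if i = n - 1 then 1 else 0))"
    using False assms by (intro sum.cong) (auto simp: eigenbasis_mat_def)
  then show ?thesis using False assms by (simp add: sum_subtractf)
qed

lemma eigencoord_mult_eigenbasis:
  assumes "(\<Sum>i<n. b $ i) \<noteq> 0"
  shows "eigencoord_mat n b * eigenbasis_mat n b = 1\<^sub>m n"
proof (rule eq_matI)
  fix j k assume "j < dim_row (1\<^sub>m n)" "k < dim_col (1\<^sub>m n)"
  then have jk: "j < n" "k < n" by auto
  have "eigenbasis_mat n b $$ (j, k) = (if k = n - 1 then b $ j else of_bool (j = k))"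
    if "j \<noteq> n - 1" using that jk by (simp add: eigenbasis_mat_def)
  then show "(eigencoord_mat n b * eigenbasis_mat n b) $$ (j, k) = 1\<^sub>m n $$ (j, k)"
    unfolding eigencoord_row_mult[OF eigenbasis_mat_carrier jk] eigenbasis_column_sum[OF jk(2)]
    using jk assms by auto
qed (auto simp: carrier_matD[OF eigencoord_mat_carrier] carrier_matD[OF eigenbasis_mat_carrier])

lemma eigenbasis_mult_eigencoord:
  assumes "(\<Sum>i<n. b $ i) \<noteq> 0"
  shows "eigenbasis_mat n b * eigencoord_mat n b = 1\<^sub>m n"
  by (rule mat_mult_left_right_inverse[OF eigencoord_mat_carrier eigenbasis_mat_carrier
      eigencoord_mult_eigenbasis[OF assms]])

lemma J_mat_row_mult:
  assumes M: "M \<in> carrier_mat n p" and jk: "j < n" "k < p"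
  shows "(J_mat n b * M) $$ (j, k) = (if j = n - 1 then (\<Sum>i<n. b $ i) * M $$ (j, k) else 0)"
  using assms by (simp add: J_mat_def mat_diag_mult_left[OF M])

text \<open>
  Every column of \<open>B_hat n b\<close> is \<open>b\<close>, whose coordinates are \<open>(0, \<dots>, 0, 1)\<close>. On the other side,
  \<open>J_mat n b\<close> keeps only the last coordinate row, which is constantly \<open>1 / s\<close> for the entry sum \<open>s\<close>
  of \<open>b\<close>, and scales it by \<open>s\<close>. So both products have last row \<open>1\<close> and all other rows \<open>0\<close>.
\<close>

lemma eigencoord_mult_B_hat:
  assumes "(\<Sum>i<n. b $ i) \<noteq> 0"
  shows "eigencoord_mat n b * B_hat n b = J_mat n b * eigencoord_mat n b"
proof (rule eq_matI)
  fix j k assume "j < dim_row (J_mat n b * eigencoord_mat n b)"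
    "k < dim_col (J_mat n b * eigencoord_mat n b)"
  then have jk: "j < n" "k < n"
    by (auto simp: carrier_matD[OF eigencoord_mat_carrier] carrier_matD[OF J_mat_carrier])
  have col: "B_hat n b $$ (i, k) = b $ i" if "i < n" for i
    using that jk by (simp add: B_hat_def)
  have "(\<Sum>i<n. B_hat n b $$ (i, k)) = (\<Sum>i<n. b $ i)"
    by (simp add: col)
  then show "(eigencoord_mat n b * B_hat n b) $$ (j, k) = (J_mat n b * eigencoord_mat n b) $$ (j, k)"
    unfolding eigencoord_row_mult[OF B_hat_carrier jk] J_mat_row_mult[OF eigencoord_mat_carrier jk]
    using assms jk by (auto simp: col eigencoord_mat_def)
qed (auto simp: carrier_matD[OF eigencoord_mat_carrier] carrier_matD[OF B_hat_carrier]
    carrier_matD[OF J_mat_carrier])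

lemma J_mat_eq_conjugate:
  assumes "(\<Sum>i<n. b $ i) \<noteq> 0"
  shows "J_mat n b = eigencoord_mat n b * B_hat n b * eigenbasis_mat n b"
  unfolding eigencoord_mult_B_hat[OF assms]
  by (simp add: assoc_mult_mat[OF J_mat_carrier eigencoord_mat_carrier eigenbasis_mat_carrier]
      eigencoord_mult_eigenbasis[OF assms] right_mult_one_mat[OF J_mat_carrier])

section \<open>The decoupled system\<close>

lemma (in vector_space) B_hat_system_iff:
  assumes "x \<in> carrier_vec n" "\<phi> \<in> carrier_vec n"
  shows "map_vec A x = mat_act scale (B_hat n b) x + \<phi> \<longleftrightarrow>
    (\<forall>j<n. A (x $ j) = (\<Sum>k<n. scale (b $ j) (x $ k)) + \<phi> $ j)"
proof -
  have "mat_act scale (B_hat n b) x $ j = (\<Sum>k<n. scale (b $ j) (x $ k))" if "j < n" for j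
    unfolding index_mat_act[OF B_hat_carrier that]
    using that by (intro sum.cong) (auto simp: B_hat_def)
  then show ?thesis
    using assms by (auto simp: vec_eq_iff carrier_matD[OF B_hat_carrier])
qed

lemma (in vector_space) mat_act_J_mat:
  assumes "j < n"
  shows "mat_act scale (J_mat n b) y $ j
    = (if j = n - 1 then scale (\<Sum>i<n. b $ i) (y $ j) else 0)"
proof -
  let ?d = "if j = n - 1 then \<Sum>i<n. b $ i else 0"
  have "mat_act scale (J_mat n b) y $ j = (\<Sum>k<n. if k = j then scale ?d (y $ j) else 0)"
    unfolding index_mat_act[OF J_mat_carrier assms]
    using assms by (intro sum.cong) (auto simp: J_mat_def mat_diag_def)
  then show ?thesis using assms by simp
qed

lemma (in vector_space) J_mat_system_iff:
  assumes "y \<in> carrier_vec n" "\<psi> \<in> carrier_vec n" and n: "0 < n"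
  shows "map_vec A y = mat_act scale (J_mat n b) y + \<psi> \<longleftrightarrow>
    (\<forall>j<n - 1. A (y $ j) = \<psi> $ j)
      \<and> A (y $ (n - 1)) = scale (\<Sum>i<n. b $ i) (y $ (n - 1)) + \<psi> $ (n - 1)"
proof -
  have split: "(\<forall>j<n. P j) \<longleftrightarrow> (\<forall>j<n - 1. P j) \<and> P (n - 1)" for P
    using n by (cases n) (auto simp: less_Suc_eq)
  have "map_vec A y = mat_act scale (J_mat n b) y + \<psi> \<longleftrightarrow>
      (\<forall>j<n. A (y $ j) = mat_act scale (J_mat n b) y $ j + \<psi> $ j)"
    using assms by (auto simp: vec_eq_iff)
  also have "\<dots> \<longleftrightarrow> (\<forall>j<n. A (y $ j)
      = (if j = n - 1 then scale (\<Sum>i<n. b $ i) (y $ j) else 0) + \<psi> $ j)"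
    by (simp add: mat_act_J_mat)
  finally show ?thesis unfolding split by auto
qed

theorem theorem4p1:
  fixes scale :: "'k::field \<Rightarrow> 'v::ab_group_add \<Rightarrow> 'v"
    and A :: "'v \<Rightarrow> 'v"
    and n :: nat
    and b :: "'k vec"
    and \<phi> :: "'v vec"
  assumes "vector_space scale"
    and "Vector_Spaces.linear scale scale A"
    and "b \<in> carrier_vec n"
    and "\<phi> \<in> carrier_vec n"
    and "(\<Sum>i<n. b $ i) \<noteq> 0"
  shows "\<exists>S S_inv. S \<in> carrier_mat n n \<and> S_inv \<in> carrier_mat n n
    \<and> invertible_mat S \<and> inverts_mat S S_inv \<and> inverts_mat S_inv S
    \<and> J_mat n b = S_inv * B_hat n b * S
    \<and> (\<forall>x \<in> carrier_vec n.
         let y = mat_act scale S_inv x; \<psi> = mat_act scale S_inv \<phi> in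
         (\<forall>j<n. A (x $ j) = (\<Sum>k<n. scale (b $ j) (x $ k)) + \<phi> $ j)
         \<longleftrightarrow>
         (\<forall>j<n - 1. A (y $ j) = \<psi> $ j)
           \<and> A (y $ (n - 1)) = scale (\<Sum>i<n. b $ i) (y $ (n - 1)) + \<psi> $ (n - 1))"
proof -
  let ?S = "eigenbasis_mat n b" and ?T = "eigencoord_mat n b"
  interpret vector_space scale by fact
  note nz = \<open>(\<Sum>i<n. b $ i) \<noteq> 0\<close>
  \<comment> \<open>An empty sum would vanish, so the last index \<open>n - 1\<close> is a genuine one.\<close>
  have n: "0 < n" using nz by (cases n) auto
  have inv: "inverts_mat ?S ?T" "inverts_mat ?T ?S"
    using eigenbasis_mult_eigencoord[OF nz] eigencoord_mult_eigenbasis[OF nz]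
    by (simp_all add: inverts_mat_def carrier_matD[OF eigenbasis_mat_carrier]
        carrier_matD[OF eigencoord_mat_carrier])
  have "invertible_mat ?S"
    using inv by (auto simp: invertible_mat_def carrier_matD[OF eigenbasis_mat_carrier])
  moreover have "(\<forall>j<n. A (x $ j) = (\<Sum>k<n. scale (b $ j) (x $ k)) + \<phi> $ j) \<longleftrightarrow>
      (\<forall>j<n - 1. A (mat_act scale ?T x $ j) = mat_act scale ?T \<phi> $ j)
        \<and> A (mat_act scale ?T x $ (n - 1))
          = scale (\<Sum>i<n. b $ i) (mat_act scale ?T x $ (n - 1)) + mat_act scale ?T \<phi> $ (n - 1)"
    if x: "x \<in> carrier_vec n" for x
    unfolding B_hat_system_iff[OF x \<open>\<phi> \<in> carrier_vec n\<close>, symmetric]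
      linear_system_change_of_unknowns[OF assms(2) eigenbasis_mat_carrier eigencoord_mat_carrier
        B_hat_carrier eigenbasis_mult_eigencoord[OF nz] x \<open>\<phi> \<in> carrier_vec n\<close>]
      J_mat_eq_conjugate[OF nz, symmetric]
    by (rule J_mat_system_iff[OF mat_act_carrier mat_act_carrier n]; rule eigencoord_mat_carrier)
  ultimately show ?thesis
    using inv J_mat_eq_conjugate[OF nz]
    by (intro exI[of _ ?S] exI[of _ ?T]) (simp add: Let_def)
qed

end
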